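(* On $\operatorname{Lip}(\mathbb{R})$, the uncentered Hardy-Littlewood maximal operator $M$ on $\mathbb{R}$ satisfies $\|M\|_{\operatorname{Op}(1)}=\sqrt2-1$.
   Context: The uncentered Hardy-Littlewood maximal function of a locally integrable $f:\mathbb{R}\to\mathbb{R}$ is $Mf(x)=\sup_{J\ni x}\frac1{|J|}\int_J|f(y)|\,dy\in[0,\infty]$, the supremum being over all bounded nondegenerate intervals $J$ containing $x$. For $f:\mathbb{R}\to\mathbb{R}$ let $\operatorname{Lip}(f)=\sup_{x\ne y}\frac{|f(x)-f(y)|}{|x-y|}$, and let $\operatorname{Lip}(\mathbb{R})$ be the set of $f$ with $\operatorname{Lip}(f)<\infty$. Then $$\|M\|_{\operatorname{Op}(1)}=\sup\Big\{\frac{\operatorname{Lip}(Mf)}{\operatorname{Lip}(f)}: 0<\operatorname{Lip}(f)<\infty\Big\}.$$ If $Mf\equiv\infty$, it is regarded as constant, i.e. $\operatorname{Lip}(Mf)=0$. *)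

theory Defs
  imports "HOL-Analysis.Analysis"
begin

definition bounded_nondegenerate_interval :: "real set \<Rightarrow> bool" where
  "bounded_nondegenerate_interval J \<longleftrightarrow> is_interval J \<and> bounded J \<and> interior J \<noteq> {}"

definition maximal_function :: "(real \<Rightarrow> real) \<Rightarrow> real \<Rightarrow> ennreal" where
  "maximal_function f x =
     (SUP J \<in> {J. bounded_nondegenerate_interval J \<and> x \<in> J}.
        (\<integral>\<^sup>+ y\<in>J. ennreal \<bar>f y\<bar> \<partial>lebesgue) / emeasure lebesgue J)"

definition Lip :: "(real \<Rightarrow> real) \<Rightarrow> ennreal" where
  "Lip f = (SUP (x, y) \<in> {(x, y). x \<noteq> y}. ennreal (\<bar>f x - f y\<bar> / \<bar>x - y\<bar>))"

(* The distance |a - b| on [0, \<infinity>]. The case distinction is needed because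
   \<infinity> - \<infinity> = \<infinity> in type ennreal. *)
definition ennreal_dist :: "ennreal \<Rightarrow> ennreal \<Rightarrow> ennreal" where
  "ennreal_dist a b = (if a = b then 0 else max a b - min a b)"

(* The Lipschitz constant of a [0, \<infinity>]-valued function. It agrees with Lip on finite-valued
   functions, and every constant function, including the constant \<infinity>, has Lipschitz constant 0. *)
definition Lip_ennreal :: "(real \<Rightarrow> ennreal) \<Rightarrow> ennreal" where
  "Lip_ennreal g = (SUP (x, y) \<in> {(x, y). x \<noteq> y}. ennreal_dist (g x) (g y) / ennreal \<bar>x - y\<bar>)"

definition Op1_norm :: "((real \<Rightarrow> real) \<Rightarrow> real \<Rightarrow> ennreal) \<Rightarrow> ennreal" where
  "Op1_norm T = (SUP f \<in> {f. 0 < Lip f \<and> Lip f < \<infinity>}. Lip_ennreal (T f) / Lip f)"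

end

theory Submission
  imports Defs
begin

text \<open>
  Let \<open>c = sqrt 2 - 1\<close>. Suppose \<open>x \<in> [a, b]\<close> and \<open>b < y\<close>, and put \<open>q = (b - a) / sqrt 2\<close> and
  \<open>z = b - q\<close>, so that \<open>[a, b] = [z - c q, z + q]\<close>. The homothety with centre \<open>z\<close> and ratio
  \<open>(q + h) / q\<close>, where \<open>h = y - b\<close>, maps \<open>[a, b]\<close> onto an interval that contains \<open>y\<close>. It moves
  \<open>z + q s\<close> by \<open>h \<bar>s\<bar>\<close>, so the average of a function with Lipschitz constant \<open>L\<close> changes by at
  most \<open>L h\<close> times the mean of \<open>\<bar>s\<bar>\<close> on \<open>[-c, 1]\<close>, and this mean is \<open>c\<close>. The centre is the point that
  minimises this loss.

  The bound is attained by the tent \<open>max 0 (1 - \<bar>x\<bar>)\<close> at the points \<open>0\<close> and \<open>1\<close>: an optimal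
  interval for the point \<open>1\<close> is \<open>[-c, 1]\<close>, over which the average is \<open>1 - c\<close>.
\<close>

section \<open>From sets to endpoints: averages as real integrals\<close>

text \<open>The endpoints are the infimum and supremum of \<open>J\<close>. They differ because a
  singleton has empty interior.\<close>

lemma bounded_nondegenerate_intervalE:
  assumes "bounded_nondegenerate_interval J"
  obtains a b where "a < b" "{a<..<b} \<subseteq> J" "J \<subseteq> {a..b}"
proof -
  have J: "is_interval J" "bounded J" "interior J \<noteq> {}"
    using assms by (auto simp: bounded_nondegenerate_interval_def)
  define a b where "a = Inf J" and "b = Sup J"
  have ne: "J \<noteq> {}" using J(3) interior_subset by blast
  have bdd: "bdd_below J" "bdd_above J"
    using J(2) by (auto simp: bounded_imp_bdd_below bounded_imp_bdd_above)
  have sub: "J \<subseteq> {a..b}"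
    using bdd by (auto simp: a_def b_def cInf_lower cSup_upper)
  have "{a<..<b} \<subseteq> J"
  proof
    fix x assume x: "x \<in> {a<..<b}"
    obtain u where u: "u \<in> J" "u < x"
      using x ne bdd by (auto simp: a_def cInf_less_iff)
    obtain v where v: "v \<in> J" "x < v"
      using x ne bdd by (auto simp: b_def less_cSup_iff)
    show "x \<in> J"
      using J(1) u v by (meson is_interval_1 less_imp_le)
  qed
  moreover have "a < b"
  proof (rule ccontr)
    assume "\<not> a < b"
    then have "J \<subseteq> {a}" using sub by auto
    then have "interior J \<subseteq> interior {a}" by (rule interior_mono)
    then show False using J(3) by simp
  qed
  ultimately show thesis using that sub by blast
qed

text \<open>\<open>J\<close> and \<open>{a..b}\<close> differ by at most two points, a null set, and
  continuity turns the Lebesgue integral into the gauge integral.\<close>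

lemma average_over_interval:
  fixes f :: "real \<Rightarrow> real"
  assumes "continuous_on UNIV f" "a < b" "{a<..<b} \<subseteq> J" "J \<subseteq> {a..b}"
  shows "(\<integral>\<^sup>+ y\<in>J. ennreal \<bar>f y\<bar> \<partial>lebesgue) / emeasure lebesgue J
           = ennreal (integral {a..b} (\<lambda>y. \<bar>f y\<bar>) / (b - a))"
proof -
  have "{a..b} - {a<..<b} \<subseteq> {a, b}" by auto
  then have "{a..b} - J \<subseteq> {a, b}" using assms(3) by blast
  then have "{a..b} - J \<in> null_sets lborel"
    by (intro finite_imp_null_set_lborel) (auto intro: finite_subset)
  then have N: "{a..b} - J \<in> null_sets lebesgue"
    by (rule null_sets_completionI)
  have Jeq: "J = {a..b} - ({a..b} - J)" using assms(4) by auto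
  have Jm: "J \<in> sets lebesgue"
    by (subst Jeq) (intro sets.Diff null_setsD2[OF N], simp)
  have em: "emeasure lebesgue J = ennreal (b - a)"
    by (subst Jeq, subst emeasure_Diff_null_set) (use N assms(2) in auto)
  have AE: "AE y in lebesgue. y \<in> J \<longleftrightarrow> y \<in> {a..b}"
    using AE_not_in[OF N] by eventually_elim (use assms(4) in auto)
  have cont: "continuous_on {a..b} (\<lambda>y. \<bar>f y\<bar>)"
    using assms(1) by (intro continuous_intros) (auto intro: continuous_on_subset)
  have "(\<integral>\<^sup>+ y\<in>J. ennreal \<bar>f y\<bar> \<partial>lebesgue) = (\<integral>\<^sup>+ y\<in>{a..b}. ennreal \<bar>f y\<bar> \<partial>lebesgue)"
    by (rule nn_integral_cong_AE) (use AE in \<open>eventually_elim, auto simp: indicator_def\<close>)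
  also have "\<dots> = (\<integral>\<^sup>+ y. ennreal (indicator {a..b} y * \<bar>f y\<bar>) \<partial>lebesgue)"
    by (rule nn_integral_cong) (auto simp: indicator_def)
  also have "\<dots> = ennreal (integral {a..b} (\<lambda>y. \<bar>f y\<bar>))"
  proof -
    have bl: "set_integrable lebesgue {a..b} (\<lambda>y. \<bar>f y\<bar>)"
      using absolutely_integrable_continuous_real[OF cont] .
    show ?thesis
      using nn_integral_eq_integral[of lebesgue "\<lambda>y. indicator {a..b} y * \<bar>f y\<bar>"] bl
        set_lebesgue_integral_eq_integral(2)[OF bl]
      by (simp add: set_integrable_def set_lebesgue_integral_def)
  qed
  finally show ?thesis
    using em assms(2) by (simp add: divide_ennreal integral_nonneg integrable_continuous_real cont)
qed

text \<open>Lets everything below argue with pairs of endpoints and real-valued integrals.\<close>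

lemma maximal_function_continuous:
  assumes "continuous_on UNIV f"
  shows "maximal_function f x =
           (SUP (a, b) \<in> {(a, b). a < b \<and> x \<in> {a..b}}. ennreal (integral {a..b} (\<lambda>y. \<bar>f y\<bar>) / (b - a)))"
    (is "_ = ?S")
proof (rule antisym)
  show "maximal_function f x \<le> ?S"
    unfolding maximal_function_def
  proof (rule SUP_least)
    fix J assume J: "J \<in> {J. bounded_nondegenerate_interval J \<and> x \<in> J}"
    then obtain a b where ab: "a < b" "{a<..<b} \<subseteq> J" "J \<subseteq> {a..b}"
      using bounded_nondegenerate_intervalE by blast
    have "(a, b) \<in> {(a, b). a < b \<and> x \<in> {a..b}}" using ab J by auto
    then show "(\<integral>\<^sup>+ y\<in>J. ennreal \<bar>f y\<bar> \<partial>lebesgue) / emeasure lebesgue J \<le> ?S"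
      unfolding average_over_interval[OF assms ab] by (rule SUP_upper2) simp
  qed
  show "?S \<le> maximal_function f x"
    unfolding maximal_function_def
  proof (rule SUP_least, clarify)
    fix a b :: real assume ab: "a < b" "x \<in> {a..b}"
    have "{a..b} \<in> {J. bounded_nondegenerate_interval J \<and> x \<in> J}"
      using ab by (auto simp: bounded_nondegenerate_interval_def is_interval_cc)
    moreover have "(\<integral>\<^sup>+ y\<in>{a..b}. ennreal \<bar>f y\<bar> \<partial>lebesgue) / emeasure lebesgue {a..b}
                     = ennreal (integral {a..b} (\<lambda>y. \<bar>f y\<bar>) / (b - a))"
      using ab by (intro average_over_interval[OF assms]) auto
    ultimately show "ennreal (integral {a..b} (\<lambda>y. \<bar>f y\<bar>) / (b - a)) \<le>
        (SUP J \<in> {J. bounded_nondegenerate_interval J \<and> x \<in> J}.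
          (\<integral>\<^sup>+ y\<in>J. ennreal \<bar>f y\<bar> \<partial>lebesgue) / emeasure lebesgue J)"
      by (intro SUP_upper2[of "{a..b}"]) auto
  qed
qed

section \<open>Averages under homotheties\<close>

lemma integral_homothety:
  fixes g :: "real \<Rightarrow> real"
  assumes "continuous_on UNIV g" "0 < q" "a \<le> b"
  shows "integral {a..b} (\<lambda>s. g (z + q * s)) = integral {z + q * a..z + q * b} g / q"
proof -
  have "(g has_integral integral {z + q * a..z + q * b} g) (cbox (z + q * a) (z + q * b))"
    using assms(1) by (auto intro!: integrable_integral integrable_continuous_real
        intro: continuous_on_subset)
  from has_integral_affinity'[OF this, of q z] assms(2)
  have "((\<lambda>s. g (q * s + z)) has_integral integral {z + q * a..z + q * b} g / q) {a..b}"
    by (simp add: divide_inverse mult.commute mult.left_commute)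
  then show ?thesis by (simp add: integral_unique add.commute)
qed

lemma integral_abs_around_0:
  fixes a b :: real
  assumes "0 \<le> a" "0 \<le> b"
  shows "((\<lambda>s. \<bar>s\<bar>) has_integral (a\<^sup>2 + b\<^sup>2) / 2) {-a..b}"
proof -
  have "((\<lambda>s. - s) has_integral - ((0\<^sup>2 - (-a)\<^sup>2) / 2)) {-a..0}"
    using assms by (intro has_integral_neg ident_has_integral) auto
  then have l: "((\<lambda>s. \<bar>s\<bar>) has_integral a\<^sup>2 / 2) {-a..0}"
    by (auto intro: has_integral_eq_rhs has_integral_eq[rotated])
  have "((\<lambda>s. s) has_integral (b\<^sup>2 - 0\<^sup>2) / 2) {0..b}"
    using assms by (intro ident_has_integral) auto
  then have r: "((\<lambda>s. \<bar>s\<bar>) has_integral b\<^sup>2 / 2) {0..b}"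
    by (auto intro: has_integral_eq_rhs has_integral_eq[rotated])
  show ?thesis
    using has_integral_combine[OF _ _ l r] assms by (simp add: add_divide_distrib)
qed

text \<open>Substitution turns both averages into means over the fixed interval [-c, 1], where the
  Lipschitz bound compares the integrands pointwise with loss L (p - q) |s|.\<close>

lemma average_homothety:
  fixes g :: "real \<Rightarrow> real"
  defines "c \<equiv> sqrt 2 - 1"
  assumes lip: "L-lipschitz_on UNIV g" and "0 < q" "q \<le> p"
  shows "integral {z - c * q..z + q} g / (sqrt 2 * q) - c * L * (p - q)
           \<le> integral {z - c * p..z + p} g / (sqrt 2 * p)"
proof -
  \<comment> \<open>\<open>c\<close> is the positive root of c^2 + 2 c = 1, which makes the mean of
    |s| over [-c, 1], that is (c^2 + 1) / (2 (c + 1)), equal to c itself.\<close>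
  have c: "0 < c" and c2: "(c\<^sup>2 + 1\<^sup>2) / 2 = sqrt 2 * c"
    by (simp_all add: c_def power2_eq_square field_simps)
  have cont: "continuous_on UNIV g" using lip by (rule lipschitz_on_continuous_on)
  have int: "(\<lambda>s. g (z + r * s)) integrable_on {-c..1}" for r
    by (intro integrable_continuous_real continuous_on_compose2[OF cont] continuous_intros) auto
  have abs: "((\<lambda>s. \<bar>s\<bar>) has_integral sqrt 2 * c) {-c..1}"
    using integral_abs_around_0[of c 1] c c2 by simp
  have "integral {-c..1} (\<lambda>s. g (z + q * s)) - L * (p - q) * (sqrt 2 * c)
          = integral {-c..1} (\<lambda>s. g (z + q * s) - L * (p - q) * \<bar>s\<bar>)"
    using has_integral_diff[OF integrable_integral[OF int[of q]] has_integral_mult_right[OF abs]]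
    by (metis integral_unique)
  also have "\<dots> \<le> integral {-c..1} (\<lambda>s. g (z + p * s))"
  proof (rule integral_le)
    show "(\<lambda>s. g (z + q * s) - L * (p - q) * \<bar>s\<bar>) integrable_on {-c..1}"
      using int abs by (intro integrable_diff integrable_on_mult_right) auto
    fix s
    have "\<bar>g (z + q * s) - g (z + p * s)\<bar> \<le> L * \<bar>(z + q * s) - (z + p * s)\<bar>"
      using lipschitz_onD[OF lip, of "z + q * s" "z + p * s"] by (simp add: dist_real_def)
    also have "(z + q * s) - (z + p * s) = - ((p - q) * s)" by (simp add: algebra_simps)
    finally show "g (z + q * s) - L * (p - q) * \<bar>s\<bar> \<le> g (z + p * s)"
      using assms by (simp add: abs_mult)
  qed (rule int)
  finally have "integral {z - c * q..z + q} g / q - L * (p - q) * (sqrt 2 * c)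
                  \<le> integral {z - c * p..z + p} g / p"
    using integral_homothety[OF cont, of q "-c" 1 z] integral_homothety[OF cont, of p "-c" 1 z]
      c \<open>0 < q\<close> \<open>q \<le> p\<close> by (simp add: mult.commute[of c])
  \<comment> \<open>The length of [-c, 1] is sqrt 2, so this division turns integrals into
    means.\<close>
  then have "(integral {z - c * q..z + q} g / q - L * (p - q) * (sqrt 2 * c)) / sqrt 2
               \<le> (integral {z - c * p..z + p} g / p) / sqrt 2"
    by (rule divide_right_mono) simp
  then show ?thesis by (simp add: diff_divide_distrib mult.commute mult.left_commute)
qed

text \<open>If the interval already reaches \<open>y\<close>, it is kept; otherwise it is enlarged
  by the homothety until its right end is \<open>y\<close>.\<close>

lemma average_move_right:
  fixes g :: "real \<Rightarrow> real"
  defines "c \<equiv> sqrt 2 - 1"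
  assumes lip: "L-lipschitz_on UNIV g" and "a < b" "x \<in> {a..b}" "x \<le> y"
  shows "\<exists>a' b'. a' < b' \<and> y \<in> {a'..b'} \<and>
           integral {a..b} g / (b - a) - c * L * (y - x) \<le> integral {a'..b'} g / (b' - a')"
proof (cases "y \<le> b")
  case True
  have "0 \<le> c * L * (y - x)" using lipschitz_on_nonneg[OF lip] assms by (simp add: c_def)
  then show ?thesis using True assms by (intro exI[of _ a] exI[of _ b]) auto
next
  case False
  define q where "q = (b - a) / sqrt 2"
  define p where "p = q + (y - b)"
  define z where "z = b - q"
  have q: "0 < q" "q \<le> p" "sqrt 2 * q = b - a" using False assms by (auto simp: q_def p_def)
  have ab: "z - c * q = a" "z + q = b" using q(3) by (auto simp: z_def c_def algebra_simps)
  have ends: "z + p = y" "z + p - (z - c * p) = sqrt 2 * p"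
    by (auto simp: z_def p_def c_def algebra_simps)
  have "integral {a..b} g / (b - a) - c * L * (p - q)
          \<le> integral {z - c * p..y} g / (sqrt 2 * p)"
    using average_homothety[OF lip q(1,2), of z] ab ends(1) q(3) by (simp add: c_def)
  \<comment> \<open>The radius grows by y - b only, and x <= b.\<close>
  moreover have "c * L * (p - q) \<le> c * L * (y - x)"
    using lipschitz_on_nonneg[OF lip] assms by (intro mult_left_mono) (auto simp: p_def c_def)
  moreover have "y - (z - c * p) = sqrt 2 * p" using ends by simp
  moreover have "0 < sqrt 2 * p" using q by simp
  ultimately show ?thesis
    by (intro exI[of _ "z - c * p"] exI[of _ y]) auto
qed

text \<open>Moving to the left is moving to the right for the reflected function.\<close>

lemma average_move:
  fixes g :: "real \<Rightarrow> real"
  defines "c \<equiv> sqrt 2 - 1"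
  assumes lip: "L-lipschitz_on UNIV g" and ab: "a < b" "x \<in> {a..b}"
  shows "\<exists>a' b'. a' < b' \<and> y \<in> {a'..b'} \<and>
           integral {a..b} g / (b - a) - c * L * \<bar>x - y\<bar> \<le> integral {a'..b'} g / (b' - a')"
proof (cases "x \<le> y")
  case True
  then show ?thesis using average_move_right[OF lip ab] by (simp add: c_def)
next
  case False
  have "L-lipschitz_on UNIV (\<lambda>t. g (- t))"
  proof (rule lipschitz_onI)
    fix s t :: real
    show "dist (g (- s)) (g (- t)) \<le> L * dist s t"
      using lipschitz_onD[OF lip, of "-s" "-t"] by (simp add: dist_real_def abs_minus_commute)
  qed (rule lipschitz_on_nonneg[OF lip])
  from average_move_right[OF this, of "-b" "-a" "-x" "-y"] False ab
  obtain a' b' where *: "a' < b'" "-y \<in> {a'..b'}"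
    "integral {-b..-a} (\<lambda>t. g (- t)) / (b - a) - c * L * (x - y)
       \<le> integral {a'..b'} (\<lambda>t. g (- t)) / (b' - a')"
    by (auto simp: c_def)
  have "integral {a'..b'} (\<lambda>t. g (- t)) = integral {-b'..-a'} g"
    using Henstock_Kurzweil_Integration.integral_reflect_real[of "-a'" "-b'" g] by simp
  then show ?thesis
    using * False by (intro exI[of _ "-b'"] exI[of _ "-a'"]) auto
qed

section \<open>The upper bound\<close>

text \<open>Each interval competing at \<open>x\<close> is moved to one competing at
  \<open>y\<close>. The additive form stays meaningful when values are infinite.\<close>

lemma maximal_function_le_add:
  assumes lip: "L-lipschitz_on UNIV f"
  shows "maximal_function f x \<le> maximal_function f y + ennreal ((sqrt 2 - 1) * L * \<bar>x - y\<bar>)"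
proof -
  have cont: "continuous_on UNIV f" using lip by (rule lipschitz_on_continuous_on)
  have lip': "L-lipschitz_on UNIV (\<lambda>t. \<bar>f t\<bar>)"
    using lip by (auto simp: lipschitz_on_def dist_real_def intro: order_trans[OF abs_triangle_ineq3])
  have L: "0 \<le> L" using lip by (rule lipschitz_on_nonneg)
  show ?thesis
    unfolding maximal_function_continuous[OF cont, of x]
  proof (rule SUP_least, clarify)
    fix a b :: real assume ab: "a < b" "x \<in> {a..b}"
    let ?e = "(sqrt 2 - 1) * L * \<bar>x - y\<bar>"
    obtain a' b' where *: "a' < b'" "y \<in> {a'..b'}"
      "integral {a..b} (\<lambda>t. \<bar>f t\<bar>) / (b - a) - ?e \<le> integral {a'..b'} (\<lambda>t. \<bar>f t\<bar>) / (b' - a')"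
      (is "?A - _ \<le> ?B")
      using average_move[OF lip' ab] by blast
    \<comment> \<open>\<open>ennreal\<close> truncates negative reals to 0, so it is additive only
      on nonnegative summands.\<close>
    have "0 \<le> ?B"
      using * lip' by (intro divide_nonneg_nonneg integral_nonneg integrable_continuous_real)
        (auto intro: continuous_on_subset lipschitz_on_continuous_on)
    then have "ennreal ?A \<le> ennreal ?B + ennreal ?e"
      using * L by (subst ennreal_plus[symmetric]) (auto intro!: ennreal_leI simp del: ennreal_plus)
    also have "ennreal ?B \<le> maximal_function f y"
      unfolding maximal_function_continuous[OF cont]
      by (rule SUP_upper2[of "(a', b')"]) (use * in auto)
    finally show "ennreal ?A \<le> maximal_function f y + ennreal ?e"
      by (simp add: add_right_mono)
  qed
qed

text \<open>If the values differ, the smaller one is finite and can be subtracted; two infinite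
  values have distance 0.\<close>

lemma ennreal_dist_le:
  assumes "a \<le> b + ennreal e" "b \<le> a + ennreal e"
  shows "ennreal_dist a b \<le> ennreal e"
proof -
  have "max a b \<le> ennreal e + min a b" using assms by (auto simp: max_def min_def add.commute)
  moreover have "a \<noteq> b \<Longrightarrow> min a b \<noteq> top" by (auto simp: min_def top_unique)
  ultimately show ?thesis
    unfolding ennreal_dist_def by (auto intro!: ennreal_minus_le_iff[THEN iffD2] simp: add.commute)
qed

text \<open>Finiteness matters, since \<open>enn2real\<close> sends infinity to 0.\<close>

lemma Lip_lipschitz_on:
  assumes "Lip f < \<infinity>"
  shows "(enn2real (Lip f))-lipschitz_on UNIV f"
proof (rule lipschitz_onI)
  fix x y :: real
  show "dist (f x) (f y) \<le> enn2real (Lip f) * dist x y"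
  proof (cases "x = y")
    case False
    have "ennreal (\<bar>f x - f y\<bar> / \<bar>x - y\<bar>) \<le> Lip f"
      unfolding Lip_def by (rule SUP_upper2[of "(x, y)"]) (use False in auto)
    then have "\<bar>f x - f y\<bar> / \<bar>x - y\<bar> \<le> enn2real (Lip f)"
      using assms by (metis enn2real_ennreal enn2real_mono abs_ge_zero divide_nonneg_nonneg
          infinity_ennreal_def)
    then show ?thesis using False by (simp add: dist_real_def field_simps)
  qed simp
qed simp

text \<open>The one-sided estimates in both directions bound \<open>ennreal_dist\<close>, which also
  covers an identically infinite maximal function.\<close>

lemma Lip_ennreal_maximal_function_le:
  assumes "0 < Lip f" "Lip f < \<infinity>"
  shows "Lip_ennreal (maximal_function f) / Lip f \<le> ennreal (sqrt 2 - 1)"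
proof -
  define L where "L = enn2real (Lip f)"
  have L: "Lip f = ennreal L" "0 < L"
    using assms by (auto simp: L_def enn2real_positive_iff ennreal_enn2real)
  have lip: "L-lipschitz_on UNIV f" using Lip_lipschitz_on[OF assms(2)] by (simp add: L_def)
  have "Lip_ennreal (maximal_function f) \<le> ennreal ((sqrt 2 - 1) * L)"
    unfolding Lip_ennreal_def
  proof (rule SUP_least, clarify)
    fix x y :: real assume "x \<noteq> y"
    have "ennreal_dist (maximal_function f x) (maximal_function f y)
            \<le> ennreal ((sqrt 2 - 1) * L * \<bar>x - y\<bar>)"
      using maximal_function_le_add[OF lip, of x y] maximal_function_le_add[OF lip, of y x]
      by (intro ennreal_dist_le) (simp_all add: abs_minus_commute)
    then have "ennreal_dist (maximal_function f x) (maximal_function f y) / ennreal \<bar>x - y\<bar>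
            \<le> ennreal ((sqrt 2 - 1) * L * \<bar>x - y\<bar>) / ennreal \<bar>x - y\<bar>"
      by (rule divide_right_mono_ennreal)
    also have "\<dots> = ennreal ((sqrt 2 - 1) * L)"
      using \<open>x \<noteq> y\<close> L by (subst divide_ennreal) auto
    finally show "ennreal_dist (maximal_function f x) (maximal_function f y) / ennreal \<bar>x - y\<bar>
            \<le> ennreal ((sqrt 2 - 1) * L)" .
  qed
  then have "Lip_ennreal (maximal_function f) / Lip f \<le> ennreal ((sqrt 2 - 1) * L) / ennreal L"
    unfolding L(1) by (rule divide_right_mono_ennreal)
  also have "\<dots> = ennreal (sqrt 2 - 1)"
    using L by (subst divide_ennreal) auto
  finally show ?thesis .
qed

section \<open>The tent function and the lower bound\<close>

definition tent :: "real \<Rightarrow> real" where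
  "tent x = max 0 (1 - \<bar>x\<bar>)"

lemma tent_nonneg [simp]: "0 \<le> tent x"
  by (simp add: tent_def)

lemma continuous_on_tent [continuous_intros]: "continuous_on S tent"
  unfolding tent_def by (intro continuous_intros)

lemma tent_integrable_on [simp]: "tent integrable_on {a..b}"
  by (intro integrable_continuous_real continuous_intros)

lemma Lip_tent: "Lip tent = 1"
proof (rule antisym)
  show "Lip tent \<le> 1"
    unfolding Lip_def
  proof (rule SUP_least, clarify)
    fix x y :: real assume "x \<noteq> y"
    moreover have "\<bar>tent x - tent y\<bar> \<le> \<bar>x - y\<bar>" by (auto simp: tent_def max_def abs_if)
    ultimately have "\<bar>tent x - tent y\<bar> / \<bar>x - y\<bar> \<le> 1" by simp
    then show "ennreal (\<bar>tent x - tent y\<bar> / \<bar>x - y\<bar>) \<le> 1"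
      by (metis ennreal_1 ennreal_leI)
  qed
  show "1 \<le> Lip tent"
    unfolding Lip_def by (rule SUP_upper2[of "(0, 1)"]) (auto simp: tent_def)
qed

lemma integral_tent_right:
  assumes "0 \<le> a" "a \<le> b" "b \<le> 1"
  shows "integral {a..b} tent = (b - a) - (b\<^sup>2 - a\<^sup>2) / 2"
proof -
  have "((\<lambda>x. 1 - x) has_integral (b - a) - (b\<^sup>2 - a\<^sup>2) / 2) {a..b}"
    using has_integral_diff[OF has_integral_const_real[of 1 a b] ident_has_integral[OF assms(2)]]
      assms by simp
  then have "(tent has_integral (b - a) - (b\<^sup>2 - a\<^sup>2) / 2) {a..b}"
    by (rule has_integral_eq[rotated]) (use assms in \<open>auto simp: tent_def\<close>)
  then show ?thesis by (rule integral_unique)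
qed

lemma integral_tent_reflect: "integral {a..b} tent = integral {-b..-a} tent"
  using Henstock_Kurzweil_Integration.integral_reflect_real[of b a tent]
  by (simp add: tent_def[abs_def])

lemma integral_tent_outside:
  assumes "1 \<le> a"
  shows "integral {a..b} tent = 0"
proof -
  have "integral {a..b} tent = integral {a..b} (\<lambda>_. 0)"
    by (rule integral_cong) (use assms in \<open>auto simp: tent_def\<close>)
  then show ?thesis by simp
qed

text \<open>The part of the interval beyond 1 adds length but no mass, so b = 1 is the extremal
  case, and the left end \<open>a\<close> is then treated by its position relative to -1 and
  0.\<close>

lemma integral_tent_le:
  assumes "a < b" "1 \<in> {a..b}"
  shows "integral {a..b} tent \<le> (2 - sqrt 2) * (b - a)"
proof -
  \<comment> \<open>Hence 2 - sqrt 2 > 1/2, which settles the two outer cases, where the average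
    over [a, 1] is at most 1/2.\<close>
  have s: "sqrt 2 < 3 / 2" by (rule real_less_lsqrt) (auto simp: power2_eq_square)
  have split: "integral {u..v} tent = integral {u..w} tent + integral {w..v} tent"
    if "u \<le> w" "w \<le> v" for u v w
    using that by (simp add: Henstock_Kurzweil_Integration.integral_combine)
  have "integral {a..b} tent = integral {a..1} tent"
    using split[of a 1 b] assms integral_tent_outside[of 1 b] by simp
  also have "\<dots> \<le> (2 - sqrt 2) * (1 - a)"
  proof -
    consider "0 \<le> a" | "-1 \<le> a" "a < 0" | "a < -1" by linarith
    then show ?thesis
    proof cases
      case 1
      have "integral {a..1} tent = (1 - a) * ((1 - a) / 2)"
        using integral_tent_right[OF 1, of 1] assms by (simp add: power2_eq_square field_simps)
      also have "\<dots> \<le> (1 - a) * (2 - sqrt 2)"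
        using 1 s assms by (intro mult_left_mono) auto
      finally show ?thesis by (simp add: mult.commute)
    next
      case 2
      have "integral {a..0} tent = - a - a\<^sup>2 / 2"
        using integral_tent_reflect[of a 0] integral_tent_right[of 0 "-a"] 2 by simp
      moreover have "integral {0..1} tent = 1 / 2" using integral_tent_right[of 0 1] by simp
      \<comment> \<open>Half of this square is exactly the difference of the two sides, so equality
        holds at a = 1 - sqrt 2.\<close>
      moreover have "0 \<le> (a + (sqrt 2 - 1))\<^sup>2" by simp
      ultimately show ?thesis
        using split[of a 0 1] 2 by (simp add: power2_eq_square algebra_simps)
    next
      case 3
      have "integral {-1..0} tent = 1 / 2"
        using integral_tent_reflect[of "-1" 0] integral_tent_right[of 0 1] by simp
      moreover have "integral {a..-1} tent = 0"
        using integral_tent_reflect[of a "-1"] integral_tent_outside[of 1 "-a"] by simp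
      moreover have "integral {0..1} tent = 1 / 2" using integral_tent_right[of 0 1] by simp
      ultimately have "integral {a..1} tent = 1"
        using split[of a "-1" 1] split[of "-1" 0 1] 3 by simp
      also have "1 \<le> (2 - sqrt 2) * 2" using s by simp
      also have "\<dots> \<le> (2 - sqrt 2) * (1 - a)" using 3 s by (intro mult_left_mono) auto
      finally show ?thesis .
    qed
  qed
  also have "\<dots> \<le> (2 - sqrt 2) * (b - a)"
    using assms s by (intro mult_left_mono) auto
  finally show ?thesis .
qed

text \<open>No single interval has average 1; the averages 1 - d/2 over [0, d] only approach it,
  hence the epsilon argument.\<close>

lemma maximal_function_tent_0: "1 \<le> maximal_function tent 0"
proof (rule ennreal_le_epsilon)
  fix e :: real assume e: "0 < e"
  \<comment> \<open>The cap at 1 keeps [0, d] where the tent is 1 - x.\<close>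
  define d where "d = min e 1"
  have d: "0 < d" "d \<le> 1" "d \<le> e" using e by (auto simp: d_def)
  have "integral {0..d} (\<lambda>t. \<bar>tent t\<bar>) / (d - 0) = 1 - d / 2"
    using integral_tent_right[of 0 d] d by (simp add: field_simps power2_eq_square)
  moreover have "ennreal (integral {0..d} (\<lambda>t. \<bar>tent t\<bar>) / (d - 0)) \<le> maximal_function tent 0"
    unfolding maximal_function_continuous[OF continuous_on_tent]
    by (rule SUP_upper2[of "(0, d)"]) (use d in auto)
  moreover have "1 \<le> ennreal (1 - d / 2) + ennreal e"
    using d by (subst ennreal_plus[symmetric]) (auto simp del: ennreal_plus simp flip: ennreal_1
        intro!: ennreal_leI)
  ultimately show "1 \<le> maximal_function tent 0 + ennreal e"
    by (metis add_right_mono order_trans)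
qed

lemma maximal_function_tent_1: "maximal_function tent 1 \<le> ennreal (2 - sqrt 2)"
  unfolding maximal_function_continuous[OF continuous_on_tent]
  by (rule SUP_least) (auto intro!: ennreal_leI simp: pos_divide_le_eq integral_tent_le)

lemma Lip_ennreal_maximal_function_tent:
  "ennreal (sqrt 2 - 1) \<le> Lip_ennreal (maximal_function tent)"
proof -
  let ?M = "maximal_function tent"
  have "2 - sqrt 2 < 1" by simp
  then have "ennreal (2 - sqrt 2) < 1" by (metis ennreal_1 ennreal_lessI zero_less_one)
  \<comment> \<open>Strictness rules out the zero branch of \<open>ennreal_dist\<close> and decides
    which value is the maximum.\<close>
  then have lt: "?M 1 < ?M 0"
    using maximal_function_tent_0 maximal_function_tent_1 by (meson le_less_trans less_le_trans)
  have "ennreal (sqrt 2 - 1) = 1 - ennreal (2 - sqrt 2)"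
    by (subst ennreal_1[symmetric], subst ennreal_minus) (auto simp: real_le_lsqrt)
  also have "\<dots> \<le> ?M 0 - ?M 1"
    using maximal_function_tent_0 maximal_function_tent_1 by (rule ennreal_minus_mono)
  also have "\<dots> = ennreal_dist (?M 0) (?M 1) / ennreal \<bar>0 - 1\<bar>"
    using lt by (auto simp: ennreal_dist_def max_def min_def divide_ennreal_def)
  also have "\<dots> \<le> Lip_ennreal ?M"
    unfolding Lip_ennreal_def by (rule SUP_upper2[of "(0, 1)"]) auto
  finally show ?thesis .
qed

theorem corollary3p6:
  shows "Op1_norm maximal_function = ennreal (sqrt 2 - 1)"
proof (rule antisym)
  show "Op1_norm maximal_function \<le> ennreal (sqrt 2 - 1)"
    unfolding Op1_norm_def by (rule SUP_least) (simp add: Lip_ennreal_maximal_function_le)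
  show "ennreal (sqrt 2 - 1) \<le> Op1_norm maximal_function"
    unfolding Op1_norm_def
    \<comment> \<open>As \<open>Lip tent\<close> is 1, the quotient is the Lipschitz constant of the
      maximal function itself.\<close>
    by (rule SUP_upper2[of tent]) (auto simp: Lip_tent divide_ennreal_def Lip_ennreal_maximal_function_tent)
qed

end
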